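(* Let $K$ be a locally compact Hausdorff space which is not $\sigma$-compact but contains a dense $\sigma$-compact subset. Then there is no standard frame in $C_0(K)$, regarded as a Hilbert module over the unitalization $\dot{C_0}(K)$ of $C_0(K)$.
   Context: A subset of a space is $\sigma$-compact if it is a countable union of compact subsets. $C_0(K)$ is the $C^*$-algebra of complex continuous functions on $K$ vanishing at infinity; it is a Hilbert module over itself, and over its unitalization, with inner product $\langle x,y\rangle=\overline{x}\,y$. $\dot{\mathcal A}$ denotes the unitalization of a $C^*$-algebra $\mathcal A$ (equal to $\mathcal A$ if $\mathcal A$ is unital). Standard frame: a family $\{x_j\}_{j\in J}$ (any index set $J$) of elements of a Hilbert $C^*$-module $\mathcal N$ over a unital $C^*$-algebra $\mathcal A$ such that there are constants $c_1,c_2>0$ for which, for every $x\in\mathcal N$, the series $\sum_{j}\langle x,x_j\rangle\langle x_j,x\rangle$ converges in norm in $\mathcal A$ and $c_1\langle x,x\rangle\le\sum_j\langle x,x_j\rangle\langle x_j,x\rangle\le c_2\langle x,x\rangle$. For a Hilbert module over a non-unital $\mathcal A$, frames are understood by viewing it as a module over $\dot{\mathcal A}$. *)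

theory Defs
  imports "HOL-Analysis.Analysis"
begin

text \<open>
  Completeness is not part of this class: C*-algebras are the complete *-subalgebras of such an
  ambient algebra, and need not contain the ambient unit.
\<close>

class pre_cstar_algebra_1 = real_normed_algebra_1 +
  fixes scaleC :: "complex \<Rightarrow> 'a \<Rightarrow> 'a" (infixr \<open>*\<^sub>C\<close> 75)
    and star :: "'a \<Rightarrow> 'a"
  assumes scaleC_add_right: "c *\<^sub>C (a + b) = c *\<^sub>C a + c *\<^sub>C b"
    and scaleC_add_left: "(c + d) *\<^sub>C a = c *\<^sub>C a + d *\<^sub>C a"
    and scaleC_scaleC: "c *\<^sub>C d *\<^sub>C a = (c * d) *\<^sub>C a"
    and scaleC_of_real: "complex_of_real r *\<^sub>C a = r *\<^sub>R a"
    and mult_scaleC_left: "(c *\<^sub>C a) * b = c *\<^sub>C (a * b)"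
    and mult_scaleC_right: "a * (c *\<^sub>C b) = c *\<^sub>C (a * b)"
    and norm_scaleC: "norm (c *\<^sub>C a) = cmod c * norm a"
    and star_add: "star (a + b) = star a + star b"
    and star_scaleC: "star (c *\<^sub>C a) = cnj c *\<^sub>C star a"
    and star_mult: "star (a * b) = star b * star a"
    and star_star: "star (star a) = a"
    and cstar_identity: "norm (star a * a) = (norm a)\<^sup>2"

lemma norm_star: "norm (star a) = norm (a :: 'a::pre_cstar_algebra_1)"
proof -
  have le: "norm b \<le> norm (star b)" for b :: 'a
  proof (cases "norm b = 0")
    case False
    have "norm b * norm b \<le> norm (star b) * norm b"
      using norm_mult_ineq[of "star b" b] by (simp add: cstar_identity power2_eq_square)
    then show ?thesis using False
      by (metis mult_right_le_imp_le norm_ge_zero order_le_less)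
  qed simp
  show ?thesis using le[of a] le[of "star a"] by (simp add: star_star)
qed

lemma scaleC_1: "1 *\<^sub>C a = (a :: 'a::pre_cstar_algebra_1)"
  using scaleC_of_real[of 1 a] by simp

lemma scaleC_0: "0 *\<^sub>C (a :: 'a::pre_cstar_algebra_1) = 0"
  using scaleC_of_real[of 0 a] by simp

lemma scaleC_minus_1: "(- 1) *\<^sub>C a = - (a :: 'a::pre_cstar_algebra_1)"
  using scaleC_of_real[of "-1" a] by simp

lemma scaleC_diff_left: "(c - d) *\<^sub>C a = c *\<^sub>C a - d *\<^sub>C (a :: 'a::pre_cstar_algebra_1)"
  using scaleC_add_left[of "c - d" d a] by (simp add: algebra_simps)

lemma star_0: "star 0 = (0 :: 'a::pre_cstar_algebra_1)"
  using norm_star[of "0 :: 'a"] by simp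

lemma star_minus: "star (- a) = - star (a :: 'a::pre_cstar_algebra_1)"
  using star_add[of a "- a"] by (simp add: star_0 add_eq_0_iff)

lemma star_diff: "star (a - b) = star a - star (b :: 'a::pre_cstar_algebra_1)"
  using star_add[of a "- b"] by (simp add: star_minus)

lemma star_1: "star 1 = (1 :: 'a::pre_cstar_algebra_1)"
  by (metis mult_1_left mult_1_right star_mult star_star)

lemma continuous_on_star: "continuous_on S (star :: 'a::pre_cstar_algebra_1 \<Rightarrow> 'a)"
  unfolding continuous_on_iff
  by (metis dist_norm norm_star star_diff)

definition cstar_subalgebra :: "'b::pre_cstar_algebra_1 set \<Rightarrow> bool" where
  "cstar_subalgebra A \<longleftrightarrow>
     0 \<in> A \<and> (\<forall>a\<in>A. \<forall>b\<in>A. a + b \<in> A) \<and> (\<forall>c. \<forall>a\<in>A. c *\<^sub>C a \<in> A) \<and>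
     (\<forall>a\<in>A. \<forall>b\<in>A. a * b \<in> A) \<and> (\<forall>a\<in>A. star a \<in> A) \<and> complete A"

definition unital :: "'b::pre_cstar_algebra_1 set \<Rightarrow> bool" where
  "unital A \<longleftrightarrow> (\<exists>e\<in>A. \<forall>a\<in>A. e * a = a \<and> a * e = a)"

text \<open>
  For a non-unital C*-subalgebra the ambient unit is not in \<open>A\<close>, the sum below is direct, and the
  inherited norm is the unique C*-norm on it, so it is the usual unitalization.
\<close>

definition unitalization :: "'b::pre_cstar_algebra_1 set \<Rightarrow> 'b set" where
  "unitalization A = (if unital A then A else {a + c *\<^sub>C 1 |a c. a \<in> A})"

definition positive_elements :: "'b::pre_cstar_algebra_1 set \<Rightarrow> 'b set" where
  "positive_elements A = {star b * b |b. b \<in> A}"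

definition cstar_le :: "'b::pre_cstar_algebra_1 set \<Rightarrow> 'b \<Rightarrow> 'b \<Rightarrow> bool" where
  "cstar_le A a b \<longleftrightarrow> b - a \<in> positive_elements A"

text \<open>
  Right Hilbert modules over a unital C*-algebra, with inner product linear in the second variable.
  The complex scalars act through the multiples of the unit of the algebra.
\<close>

locale hilbert_module =
  fixes A :: "'b::pre_cstar_algebra_1 set"
    and N :: "'m::ab_group_add set"
    and act :: "'m \<Rightarrow> 'b \<Rightarrow> 'm"
    and ip :: "'m \<Rightarrow> 'm \<Rightarrow> 'b"
  assumes algebra: "cstar_subalgebra A"
    and unit: "\<exists>e\<in>A. (\<forall>a\<in>A. e * a = a \<and> a * e = a) \<and> (\<forall>x\<in>N. act x e = x)"
    and zero_closed: "0 \<in> N"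
    and add_closed: "x \<in> N \<Longrightarrow> y \<in> N \<Longrightarrow> x + y \<in> N"
    and uminus_closed: "x \<in> N \<Longrightarrow> - x \<in> N"
    and act_closed: "x \<in> N \<Longrightarrow> a \<in> A \<Longrightarrow> act x a \<in> N"
    and act_add_left: "x \<in> N \<Longrightarrow> y \<in> N \<Longrightarrow> a \<in> A \<Longrightarrow> act (x + y) a = act x a + act y a"
    and act_add_right: "x \<in> N \<Longrightarrow> a \<in> A \<Longrightarrow> b \<in> A \<Longrightarrow> act x (a + b) = act x a + act x b"
    and act_act: "x \<in> N \<Longrightarrow> a \<in> A \<Longrightarrow> b \<in> A \<Longrightarrow> act (act x a) b = act x (a * b)"
    and ip_closed: "x \<in> N \<Longrightarrow> y \<in> N \<Longrightarrow> ip x y \<in> A"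
    and ip_add: "x \<in> N \<Longrightarrow> y \<in> N \<Longrightarrow> z \<in> N \<Longrightarrow> ip x (y + z) = ip x y + ip x z"
    and ip_act: "x \<in> N \<Longrightarrow> y \<in> N \<Longrightarrow> a \<in> A \<Longrightarrow> ip x (act y a) = ip x y * a"
    and ip_star: "x \<in> N \<Longrightarrow> y \<in> N \<Longrightarrow> ip y x = star (ip x y)"
    and ip_positive: "x \<in> N \<Longrightarrow> ip x x \<in> positive_elements A"
    and ip_definite: "x \<in> N \<Longrightarrow> ip x x = 0 \<Longrightarrow> x = 0"
    and complete_module:
      "(\<And>n. X n \<in> N) \<Longrightarrow>
       (\<And>e. e > 0 \<Longrightarrow> \<exists>M. \<forall>m\<ge>M. \<forall>n\<ge>M. sqrt (norm (ip (X m - X n) (X m - X n))) < e) \<Longrightarrow>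
       \<exists>x\<in>N. (\<lambda>n. sqrt (norm (ip (X n - x) (X n - x)))) \<longlonglongrightarrow> 0"

definition standard_frame ::
    "'b::pre_cstar_algebra_1 set \<Rightarrow> 'm set \<Rightarrow> ('m \<Rightarrow> 'm \<Rightarrow> 'b) \<Rightarrow> 'j set \<Rightarrow> ('j \<Rightarrow> 'm) \<Rightarrow> bool" where
  "standard_frame A N ip J x \<longleftrightarrow>
     (\<forall>j\<in>J. x j \<in> N) \<and>
     (\<exists>c\<^sub>1>0. \<exists>c\<^sub>2>0. \<forall>y\<in>N. \<exists>s\<in>A.
        ((\<lambda>j. ip y (x j) * ip (x j) y) has_sum s) J \<and>
        cstar_le A (c\<^sub>1 *\<^sub>R ip y y) s \<and> cstar_le A s (c\<^sub>2 *\<^sub>R ip y y))"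

instantiation complex :: pre_cstar_algebra_1
begin

definition scaleC_complex :: "complex \<Rightarrow> complex \<Rightarrow> complex" where
  "scaleC_complex c a = c * a"

definition star_complex :: "complex \<Rightarrow> complex" where
  "star_complex = cnj"

instance
proof
  fix a b c d :: complex and r :: real
  show "c *\<^sub>C (a + b) = c *\<^sub>C a + c *\<^sub>C b" by (simp add: scaleC_complex_def distrib_left)
  show "(c + d) *\<^sub>C a = c *\<^sub>C a + d *\<^sub>C a" by (simp add: scaleC_complex_def distrib_right)
  show "c *\<^sub>C d *\<^sub>C a = (c * d) *\<^sub>C a" by (simp add: scaleC_complex_def mult.assoc)
  show "complex_of_real r *\<^sub>C a = r *\<^sub>R a" by (simp add: scaleC_complex_def scaleR_conv_of_real)
  show "(c *\<^sub>C a) * b = c *\<^sub>C (a * b)" by (simp add: scaleC_complex_def mult.assoc)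
  show "a * (c *\<^sub>C b) = c *\<^sub>C (a * b)" by (simp add: scaleC_complex_def mult.left_commute)
  show "norm (c *\<^sub>C a) = cmod c * norm a" by (simp add: scaleC_complex_def norm_mult)
  show "star (a + b) = star a + star b" by (simp add: star_complex_def)
  show "star (c *\<^sub>C a) = cnj c *\<^sub>C star a" by (simp add: scaleC_complex_def star_complex_def)
  show "star (a * b) = star b * star a" by (simp add: star_complex_def mult.commute)
  show "star (star a) = a" by (simp add: star_complex_def)
  show "norm (star a * a) = (norm a)\<^sup>2" by (simp add: star_complex_def norm_mult power2_eq_square)
qed

end

unbundle bcontfun.lifting

instantiation bcontfun :: (topological_space, real_normed_algebra_1) real_normed_algebra_1
begin

lift_definition one_bcontfun :: "'a \<Rightarrow>\<^sub>C 'b" is "\<lambda>_. 1"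
  by (rule const_bcontfun)

lift_definition times_bcontfun :: "('a \<Rightarrow>\<^sub>C 'b) \<Rightarrow> ('a \<Rightarrow>\<^sub>C 'b) \<Rightarrow> 'a \<Rightarrow>\<^sub>C 'b"
  is "\<lambda>f g t. f t * g t"
proof -
  fix f g :: "'a \<Rightarrow> 'b"
  assume f: "f \<in> bcontfun" and g: "g \<in> bcontfun"
  obtain B where B: "\<And>t. norm (f t) \<le> B"
    using f by (auto simp: bcontfun_def bounded_iff)
  obtain C where C: "\<And>t. norm (g t) \<le> C"
    using g by (auto simp: bcontfun_def bounded_iff)
  show "(\<lambda>t. f t * g t) \<in> bcontfun"
  proof (rule bcontfun_normI[where b = "B * C"])
    show "continuous_on UNIV (\<lambda>t. f t * g t)"
      using f g by (auto simp: bcontfun_def intro: continuous_intros)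
    fix t
    show "norm (f t * g t) \<le> B * C"
      using norm_mult_ineq[of "f t" "g t"] mult_mono[OF B C, of t t]
      by (smt (verit) norm_ge_zero B)
  qed
qed

instance
proof
  fix a b c :: "'a \<Rightarrow>\<^sub>C 'b" and r :: real
  show "a * b * c = a * (b * c)" by transfer (simp add: mult.assoc)
  show "(a + b) * c = a * c + b * c" by transfer (simp add: distrib_right)
  show "a * (b + c) = a * b + a * c" by transfer (simp add: distrib_left)
  show "r *\<^sub>R a * b = r *\<^sub>R (a * b)" by transfer simp
  show "a * r *\<^sub>R b = r *\<^sub>R (a * b)" by transfer simp
  show "1 * a = a" by transfer simp
  show "a * 1 = a" by transfer simp
  show "(0 :: 'a \<Rightarrow>\<^sub>C 'b) \<noteq> 1" by transfer (simp add: fun_eq_iff)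
  show "norm (a * b) \<le> norm a * norm b"
  proof (rule norm_bound)
    fix t
    have "norm (apply_bcontfun (a * b) t) \<le> norm (apply_bcontfun a t) * norm (apply_bcontfun b t)"
      by (simp add: times_bcontfun.rep_eq norm_mult_ineq)
    also have "\<dots> \<le> norm a * norm b"
      by (intro mult_mono norm_bounded) auto
    finally show "norm (apply_bcontfun (a * b) t) \<le> norm a * norm b" .
  qed
  show "norm (1 :: 'a \<Rightarrow>\<^sub>C 'b) = 1"
  proof (rule antisym)
    show "norm (1 :: 'a \<Rightarrow>\<^sub>C 'b) \<le> 1"
      by (rule norm_bound) (simp add: one_bcontfun.rep_eq)
    show "1 \<le> norm (1 :: 'a \<Rightarrow>\<^sub>C 'b)"
      using norm_bounded[of "1 :: 'a \<Rightarrow>\<^sub>C 'b" undefined] by (simp add: one_bcontfun.rep_eq)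
  qed
qed

end

instantiation bcontfun :: (topological_space, pre_cstar_algebra_1) pre_cstar_algebra_1
begin

lift_definition scaleC_bcontfun :: "complex \<Rightarrow> ('a \<Rightarrow>\<^sub>C 'b) \<Rightarrow> 'a \<Rightarrow>\<^sub>C 'b"
  is "\<lambda>c f t. c *\<^sub>C f t"
proof -
  fix c and f :: "'a \<Rightarrow> 'b"
  assume f: "f \<in> bcontfun"
  have "(\<lambda>_. c *\<^sub>C 1) \<in> (bcontfun :: ('a \<Rightarrow> 'b) set)" by (rule const_bcontfun)
  with f have "(\<lambda>t. (c *\<^sub>C 1) * f t) \<in> bcontfun"
    by (metis (no_types, lifting) apply_bcontfun bcontfunE ext times_bcontfun.rep_eq)
  then show "(\<lambda>t. c *\<^sub>C f t) \<in> bcontfun" by (simp add: mult_scaleC_left)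
qed

lift_definition star_bcontfun :: "('a \<Rightarrow>\<^sub>C 'b) \<Rightarrow> 'a \<Rightarrow>\<^sub>C 'b" is "\<lambda>f t. star (f t)"
proof -
  fix f :: "'a \<Rightarrow> 'b"
  assume f: "f \<in> bcontfun"
  then obtain B where "\<And>t. norm (f t) \<le> B" by (auto simp: bcontfun_def bounded_iff)
  moreover have "continuous_on UNIV (\<lambda>t. star (f t))"
    using f continuous_on_compose2[OF continuous_on_star[of UNIV]] by (auto simp: bcontfun_def)
  ultimately show "(\<lambda>t. star (f t)) \<in> bcontfun"
    by (intro bcontfun_normI[where b = B]) (auto simp: norm_star)
qed

instance
proof
  fix a b :: "'a \<Rightarrow>\<^sub>C 'b" and c d :: complex and r :: real
  show "c *\<^sub>C (a + b) = c *\<^sub>C a + c *\<^sub>C b" by transfer (simp add: scaleC_add_right)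
  show "(c + d) *\<^sub>C a = c *\<^sub>C a + d *\<^sub>C a" by transfer (simp add: scaleC_add_left)
  show "c *\<^sub>C d *\<^sub>C a = (c * d) *\<^sub>C a" by transfer (simp add: scaleC_scaleC)
  show "complex_of_real r *\<^sub>C a = r *\<^sub>R a" by transfer (simp add: scaleC_of_real)
  show "(c *\<^sub>C a) * b = c *\<^sub>C (a * b)" by transfer (simp add: mult_scaleC_left)
  show "a * (c *\<^sub>C b) = c *\<^sub>C (a * b)" by transfer (simp add: mult_scaleC_right)
  show "star (a + b) = star a + star b" by transfer (simp add: star_add)
  show sc: "star (c *\<^sub>C a) = cnj c *\<^sub>C star a" by transfer (simp add: star_scaleC)
  show "star (a * b) = star b * star a" by transfer (simp add: star_mult)
  show "star (star a) = a" by transfer (simp add: star_star)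
  have le: "norm (c *\<^sub>C a) \<le> cmod c * norm a" for c and a :: "'a \<Rightarrow>\<^sub>C 'b"
    by (rule norm_bound)
      (simp add: scaleC_bcontfun.rep_eq norm_scaleC mult_left_mono norm_bounded)
  show "norm (c *\<^sub>C a) = cmod c * norm a"
  proof (cases "c = 0")
    case True
    then show ?thesis using le[of c a] by simp
  next
    case False
    have "a = inverse c *\<^sub>C (c *\<^sub>C a)"
      using False by transfer (simp add: scaleC_scaleC scaleC_1)
    then have "norm a \<le> cmod (inverse c) * norm (c *\<^sub>C a)"
      using le[of "inverse c" "c *\<^sub>C a"] by simp
    then have "cmod c * norm a \<le> norm (c *\<^sub>C a)"
      using False by (simp add: norm_divide field_simps)
    then show ?thesis using le[of c a] by simp
  qed
  have pt: "norm (apply_bcontfun (star a * a) t) = (norm (apply_bcontfun a t))\<^sup>2" for t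
    by (simp add: times_bcontfun.rep_eq star_bcontfun.rep_eq cstar_identity)
  show "norm (star a * a) = (norm a)\<^sup>2"
  proof (rule antisym)
    show "norm (star a * a) \<le> (norm a)\<^sup>2"
      by (rule norm_bound) (simp add: pt norm_bounded power_mono)
    have "norm a \<le> sqrt (norm (star a * a))"
      by (rule norm_bound) (metis norm_bounded pt real_le_rsqrt)
    then have "(norm a)\<^sup>2 \<le> (sqrt (norm (star a * a)))\<^sup>2"
      by (rule power_mono) simp
    then show "(norm a)\<^sup>2 \<le> norm (star a * a)" by simp
  qed
qed

end

lifting_update bcontfun.lifting
lifting_forget bcontfun.lifting

lemmas bcontfun_cstar_apply [simp] =
  one_bcontfun.rep_eq times_bcontfun.rep_eq scaleC_bcontfun.rep_eq star_bcontfun.rep_eq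

definition vanishes_at_infinity :: "('a::topological_space \<Rightarrow> complex) \<Rightarrow> bool" where
  "vanishes_at_infinity f \<longleftrightarrow> (\<forall>e>0. \<exists>C. compact C \<and> (\<forall>t. t \<notin> C \<longrightarrow> cmod (f t) < e))"

definition C\<^sub>0 :: "('a::topological_space \<Rightarrow>\<^sub>C complex) set" where
  "C\<^sub>0 = {f. vanishes_at_infinity (apply_bcontfun f)}"

definition C\<^sub>0_inner ::
    "('a::topological_space \<Rightarrow>\<^sub>C complex) \<Rightarrow> ('a \<Rightarrow>\<^sub>C complex) \<Rightarrow> 'a \<Rightarrow>\<^sub>C complex" where
  "C\<^sub>0_inner x y = star x * y"

definition sigma_compact :: "'a::topological_space set \<Rightarrow> bool" where
  "sigma_compact S \<longleftrightarrow> (countable union_of compact) S"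

text \<open>Boundedness is no restriction: it follows from vanishing at infinity.\<close>

lemma apply_bcontfun_image_C\<^sub>0:
  "apply_bcontfun ` (C\<^sub>0 :: ('a::topological_space \<Rightarrow>\<^sub>C complex) set) =
    {f. continuous_on UNIV f \<and> vanishes_at_infinity f}"
proof (intro set_eqI iffI)
  fix f :: "'a \<Rightarrow> complex"
  assume "f \<in> {f. continuous_on UNIV f \<and> vanishes_at_infinity f}"
  then have c: "continuous_on UNIV f" and v: "vanishes_at_infinity f" by auto
  obtain C where C: "compact C" "\<And>t. t \<notin> C \<Longrightarrow> cmod (f t) < 1"
    using v unfolding vanishes_at_infinity_def by (meson zero_less_one)
  have "bounded (f ` C)"
    using C(1) c by (meson compact_continuous_image compact_imp_bounded continuous_on_subset subset_UNIV)
  then obtain B where B: "\<And>t. t \<in> C \<Longrightarrow> cmod (f t) \<le> B" by (auto simp: bounded_iff)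
  have "cmod (f t) \<le> max B 1" for t
    using B[of t] C(2)[of t] by (cases "t \<in> C") auto
  then have "f \<in> bcontfun" using c by (rule bcontfun_normI[rotated])
  then obtain g where "f = apply_bcontfun g" by (rule bcontfunE)
  with v show "f \<in> apply_bcontfun ` C\<^sub>0" by (auto simp: C\<^sub>0_def)
next
  fix f :: "'a \<Rightarrow> complex"
  assume "f \<in> apply_bcontfun ` C\<^sub>0"
  then obtain g where "f = apply_bcontfun g" "g \<in> C\<^sub>0" by blast
  then show "f \<in> {f. continuous_on UNIV f \<and> vanishes_at_infinity f}"
    using continuous_on_apply_bcontfun[of UNIV g] by (simp add: C\<^sub>0_def)
qed

lemma cstar_subalgebra_diff:
  assumes "cstar_subalgebra A" "a \<in> A" "b \<in> A"
  shows "a - b \<in> A"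
proof -
  have "a + (- 1) *\<^sub>C b \<in> A" using assms unfolding cstar_subalgebra_def by blast
  then show ?thesis by (simp add: scaleC_minus_1)
qed

lemma cstar_subalgebra_unitalization:
  fixes A :: "'b::pre_cstar_algebra_1 set"
  assumes A: "cstar_subalgebra A"
  shows "cstar_subalgebra (unitalization A)"
proof (cases "unital A")
  case True
  then show ?thesis using A by (simp add: unitalization_def)
next
  case False
  then have U: "unitalization A = {a + c *\<^sub>C 1 |a c. a \<in> A}" by (simp add: unitalization_def)
  have one: "1 \<notin> A" using False by (auto simp: unital_def)
  have z: "0 \<in> A" and ad: "\<And>a b. a \<in> A \<Longrightarrow> b \<in> A \<Longrightarrow> a + b \<in> A"
    and sc: "\<And>c a. a \<in> A \<Longrightarrow> c *\<^sub>C a \<in> A" and mu: "\<And>a b. a \<in> A \<Longrightarrow> b \<in> A \<Longrightarrow> a * b \<in> A"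
    and st: "\<And>a. a \<in> A \<Longrightarrow> star a \<in> A" and co: "complete A"
    using A unfolding cstar_subalgebra_def by auto
  have UI: "u \<in> unitalization A" if "u = a + c *\<^sub>C 1" "a \<in> A" for u a c
    using that U by blast
  define d where "d = infdist 1 A"
  have "closed A" using co by (rule complete_imp_closed)
  then have d: "d > 0" unfolding d_def using one z
    by (metis empty_iff in_closed_iff_infdist_zero infdist_nonneg order_le_less)
  have key: "cmod c * d \<le> norm (a + c *\<^sub>C 1)" if "a \<in> A" for a c
  proof (cases "c = 0")
    case False
    let ?b = "(- inverse c) *\<^sub>C a"
    have "d \<le> dist 1 ?b" unfolding d_def using that by (intro infdist_le sc)
    moreover have "a + c *\<^sub>C 1 = c *\<^sub>C (1 - ?b)"
    proof -
      have "c *\<^sub>C (1 - ?b) = c *\<^sub>C (1 + (- 1) *\<^sub>C ?b)" by (simp add: scaleC_minus_1)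
      also have "\<dots> = c *\<^sub>C 1 + (c * (- 1 * - inverse c)) *\<^sub>C a"
        by (simp only: scaleC_add_right scaleC_scaleC mult.assoc)
      also have "\<dots> = a + c *\<^sub>C 1" using False by (simp add: scaleC_1 add.commute)
      finally show ?thesis ..
    qed
    ultimately show ?thesis by (simp add: norm_scaleC dist_norm mult_left_mono)
  qed simp
  have "complete (unitalization A)"
    unfolding complete_def
  proof (intro allI impI)
    fix u :: "nat \<Rightarrow> 'b"
    assume u: "(\<forall>n. u n \<in> unitalization A) \<and> Cauchy u"
    then have "\<forall>n. \<exists>a c. a \<in> A \<and> u n = a + c *\<^sub>C 1" using U by blast
    then obtain a c where ac: "\<And>n. a n \<in> A" "\<And>n. u n = a n + c n *\<^sub>C 1" by metis
    have cle: "cmod (c m - c n) * d \<le> norm (u m - u n)" for m n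
      using key[OF cstar_subalgebra_diff[OF A ac(1)[of m] ac(1)[of n]], of "c m - c n"]
      by (simp add: ac(2) scaleC_diff_left algebra_simps)
    have "Cauchy c"
    proof (rule metric_CauchyI)
      fix e :: real assume "e > 0"
      then obtain M where M: "\<And>m n. m \<ge> M \<Longrightarrow> n \<ge> M \<Longrightarrow> dist (u m) (u n) < e * d"
        using u d by (meson metric_CauchyD mult_pos_pos)
      show "\<exists>M. \<forall>m\<ge>M. \<forall>n\<ge>M. dist (c m) (c n) < e"
      proof (intro exI allI impI)
        fix m n assume "M \<le> m" "M \<le> n"
        then have "cmod (c m - c n) * d < e * d"
          using M[of m n] cle[of m n] by (simp add: dist_norm)
        then show "dist (c m) (c n) < e" using d by (simp add: dist_norm)
      qed
    qed
    then obtain k where k: "c \<longlonglongrightarrow> k" using Cauchy_convergent_iff convergent_def by blast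
    have k1: "(\<lambda>n. c n *\<^sub>C (1::'b)) \<longlonglongrightarrow> k *\<^sub>C 1"
      using k unfolding tendsto_iff dist_norm scaleC_diff_left[symmetric] norm_scaleC by simp
    have "Cauchy (\<lambda>n. u n - c n *\<^sub>C 1)"
    proof (rule metric_CauchyI)
      fix e :: real assume "e > 0"
      then have e: "e / 2 > 0" by simp
      obtain M1 where M1: "\<And>m n. m \<ge> M1 \<Longrightarrow> n \<ge> M1 \<Longrightarrow> dist (u m) (u n) < e / 2"
        using u e by (meson metric_CauchyD)
      obtain M2 where M2: "\<And>m n. m \<ge> M2 \<Longrightarrow> n \<ge> M2 \<Longrightarrow> dist (c m) (c n) < e / 2"
        using \<open>Cauchy c\<close> e by (meson metric_CauchyD)
      show "\<exists>M. \<forall>m\<ge>M. \<forall>n\<ge>M. dist (u m - c m *\<^sub>C 1) (u n - c n *\<^sub>C 1) < e"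
      proof (intro exI allI impI)
        fix m n assume "max M1 M2 \<le> m" "max M1 M2 \<le> n"
        then have "norm (u m - u n) < e / 2" "cmod (c m - c n) < e / 2"
          using M1[of m n] M2[of m n] by (auto simp: dist_norm)
        moreover have "norm ((u m - u n) - (c m - c n) *\<^sub>C (1::'b)) \<le>
            norm (u m - u n) + cmod (c m - c n)"
          using norm_triangle_ineq4[of "u m - u n" "(c m - c n) *\<^sub>C (1::'b)"]
          by (simp add: norm_scaleC)
        ultimately show "dist (u m - c m *\<^sub>C 1) (u n - c n *\<^sub>C 1) < e"
          by (simp add: dist_norm scaleC_diff_left algebra_simps)
      qed
    qed
    then have "Cauchy a" by (simp add: ac(2))
    then obtain l where l: "l \<in> A" "a \<longlonglongrightarrow> l" using co ac(1) unfolding complete_def by blast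
    have "(\<lambda>n. a n + c n *\<^sub>C 1) \<longlonglongrightarrow> l + k *\<^sub>C 1" using l(2) k1 by (rule tendsto_add)
    then have "u \<longlonglongrightarrow> l + k *\<^sub>C 1" using ac(2) by presburger
    then show "\<exists>l\<in>unitalization A. u \<longlonglongrightarrow> l" using UI[OF refl l(1)] by blast
  qed
  moreover have "0 \<in> unitalization A" by (rule UI[of _ 0 0]) (simp_all add: z scaleC_0)
  moreover have "x + y \<in> unitalization A" "x * y \<in> unitalization A"
    if x: "x \<in> unitalization A" and y: "y \<in> unitalization A" for x y
  proof -
    obtain a c where 1: "x = a + c *\<^sub>C 1" "a \<in> A" using x U by blast
    obtain b k where 2: "y = b + k *\<^sub>C 1" "b \<in> A" using y U by blast
    show "x + y \<in> unitalization A"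
      by (rule UI[of _ "a + b" "c + k"]) (simp_all add: 1 2 ad scaleC_add_left algebra_simps)
    show "x * y \<in> unitalization A"
      by (rule UI[of _ "a * b + k *\<^sub>C a + c *\<^sub>C b" "c * k"])
        (simp_all add: 1 2 ad mu sc distrib_left distrib_right mult_scaleC_left mult_scaleC_right
          scaleC_add_right scaleC_scaleC mult.commute add_ac)
  qed
  moreover have "c *\<^sub>C x \<in> unitalization A" "star x \<in> unitalization A"
    if x: "x \<in> unitalization A" for c x
  proof -
    obtain a k where 1: "x = a + k *\<^sub>C 1" "a \<in> A" using x U by blast
    show "c *\<^sub>C x \<in> unitalization A"
      by (rule UI[of _ "c *\<^sub>C a" "c * k"]) (simp_all add: 1 sc scaleC_add_right scaleC_scaleC)
    show "star x \<in> unitalization A"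
      by (rule UI[of _ "star a" "cnj k"]) (simp_all add: 1 st star_add star_scaleC star_1)
  qed
  ultimately show ?thesis unfolding cstar_subalgebra_def by (intro conjI ballI allI)
qed

lemma subset_unitalization: "A \<subseteq> unitalization A"
  unfolding unitalization_def
  by (auto, metis add.right_neutral scaleC_0)

lemma C\<^sub>0_add: "f \<in> C\<^sub>0 \<Longrightarrow> g \<in> C\<^sub>0 \<Longrightarrow> f + g \<in> C\<^sub>0"
  unfolding C\<^sub>0_def vanishes_at_infinity_def mem_Collect_eq
proof (intro allI impI)
  fix e :: real
  assume f: "\<forall>e>0. \<exists>C. compact C \<and> (\<forall>t. t \<notin> C \<longrightarrow> cmod (apply_bcontfun f t) < e)"
    and g: "\<forall>e>0. \<exists>C. compact C \<and> (\<forall>t. t \<notin> C \<longrightarrow> cmod (apply_bcontfun g t) < e)"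
    and "e > 0"
  then have "e / 2 > 0" by simp
  obtain C where C: "compact C" "\<And>t. t \<notin> C \<Longrightarrow> cmod (apply_bcontfun f t) < e / 2"
    using f \<open>e / 2 > 0\<close> by blast
  obtain D where D: "compact D" "\<And>t. t \<notin> D \<Longrightarrow> cmod (apply_bcontfun g t) < e / 2"
    using g \<open>e / 2 > 0\<close> by blast
  have "cmod (apply_bcontfun (f + g) t) < e" if "t \<notin> C \<union> D" for t
    using C(2)[of t] D(2)[of t] that
      norm_triangle_ineq[of "apply_bcontfun f t" "apply_bcontfun g t"] by simp
  then show "\<exists>C. compact C \<and> (\<forall>t. t \<notin> C \<longrightarrow> cmod (apply_bcontfun (f + g) t) < e)"
    using compact_Un[OF C(1) D(1)] by blast
qed

lemma C\<^sub>0_mult_right: "f * g \<in> C\<^sub>0" if f: "f \<in> C\<^sub>0"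
  unfolding C\<^sub>0_def vanishes_at_infinity_def mem_Collect_eq
proof (intro allI impI)
  fix e :: real assume e: "e > 0"
  let ?B = "norm g + 1"
  have B: "?B > 0" by (simp add: add_nonneg_pos)
  then have "e / ?B > 0" using e by simp
  then obtain C where C: "compact C" "\<And>t. t \<notin> C \<Longrightarrow> cmod (apply_bcontfun f t) < e / ?B"
    using f unfolding C\<^sub>0_def vanishes_at_infinity_def by blast
  have "cmod (apply_bcontfun (f * g) t) < e" if "t \<notin> C" for t
  proof -
    have "cmod (apply_bcontfun (f * g) t) \<le> cmod (apply_bcontfun f t) * ?B"
      using norm_bounded[of g t] by (simp add: norm_mult mult_left_mono)
    also have "\<dots> < e" using C(2)[OF that] B by (simp add: field_simps)
    finally show ?thesis .
  qed
  then show "\<exists>C. compact C \<and> (\<forall>t. t \<notin> C \<longrightarrow> cmod (apply_bcontfun (f * g) t) < e)"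
    using C(1) by blast
qed

lemma C\<^sub>0_star: "f \<in> C\<^sub>0 \<Longrightarrow> star f \<in> C\<^sub>0"
  by (simp add: C\<^sub>0_def vanishes_at_infinity_def star_complex_def)

lemma C\<^sub>0_scaleC: "f \<in> C\<^sub>0 \<Longrightarrow> c *\<^sub>C f \<in> C\<^sub>0"
  using C\<^sub>0_mult_right[of f "c *\<^sub>C 1"] by (simp add: mult_scaleC_right)

lemma C\<^sub>0_zero: "0 \<in> C\<^sub>0"
  by (auto simp: C\<^sub>0_def vanishes_at_infinity_def intro: exI[of _ "{}"])

lemma complete_C\<^sub>0: "complete (C\<^sub>0 :: ('a::topological_space \<Rightarrow>\<^sub>C complex) set)"
  unfolding complete_def
proof (intro allI impI)
  fix f :: "nat \<Rightarrow> 'a \<Rightarrow>\<^sub>C complex"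
  assume f: "(\<forall>n. f n \<in> C\<^sub>0) \<and> Cauchy f"
  then have "Cauchy f" ..
  have "\<forall>e>0. \<exists>N. \<forall>m n t. N \<le> m \<and> N \<le> n \<and> True \<longrightarrow>
      dist (apply_bcontfun (f m) t) (apply_bcontfun (f n) t) < e"
  proof (intro allI impI)
    fix e :: real assume "e > 0"
    then obtain N where "\<And>m n. m \<ge> N \<Longrightarrow> n \<ge> N \<Longrightarrow> dist (f m) (f n) < e"
      using \<open>Cauchy f\<close> by (meson metric_CauchyD)
    then show "\<exists>N. \<forall>m n t. N \<le> m \<and> N \<le> n \<and> True \<longrightarrow>
        dist (apply_bcontfun (f m) t) (apply_bcontfun (f n) t) < e"
      using dist_fun_lt_imp_dist_val_lt by blast
  qed
  then obtain g where "\<forall>e>0. \<exists>N. \<forall>n t. N \<le> n \<and> True \<longrightarrow> dist (apply_bcontfun (f n) t) (g t) < e"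
    using uniformly_convergent_eq_cauchy[of "\<lambda>_. True" "\<lambda>n. apply_bcontfun (f n)"] by blast
  then have "uniform_limit UNIV (\<lambda>n. apply_bcontfun (f n)) g sequentially"
    by (simp add: uniform_limit_sequentially_iff)
  from uniform_limit_bcontfunE[OF this sequentially_bot]
  obtain l where l: "f \<longlonglongrightarrow> l" by blast
  have "l \<in> C\<^sub>0"
    unfolding C\<^sub>0_def vanishes_at_infinity_def mem_Collect_eq
  proof (intro allI impI)
    fix e :: real assume "e > 0"
    then have e: "e / 2 > 0" by simp
    obtain n where n: "dist (f n) l < e / 2" using l e by (meson LIMSEQ_def le_refl)
    obtain C where C: "compact C" "\<And>t. t \<notin> C \<Longrightarrow> cmod (apply_bcontfun (f n) t) < e / 2"
      using f e unfolding C\<^sub>0_def vanishes_at_infinity_def by blast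
    have "cmod (apply_bcontfun l t) < e" if "t \<notin> C" for t
      using C(2)[OF that] dist_fun_lt_imp_dist_val_lt[OF n, of t]
        norm_triangle_ineq2[of "apply_bcontfun l t" "apply_bcontfun (f n) t"]
      by (simp add: dist_norm norm_minus_commute)
    then show "\<exists>C. compact C \<and> (\<forall>t. t \<notin> C \<longrightarrow> cmod (apply_bcontfun l t) < e)"
      using C(1) by blast
  qed
  then show "\<exists>l\<in>C\<^sub>0. f \<longlonglongrightarrow> l" using l by blast
qed

lemma cstar_subalgebra_C\<^sub>0: "cstar_subalgebra C\<^sub>0"
  unfolding cstar_subalgebra_def
  by (intro conjI ballI allI C\<^sub>0_zero C\<^sub>0_add C\<^sub>0_scaleC C\<^sub>0_mult_right C\<^sub>0_star complete_C\<^sub>0)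

lemma hilbert_module_C\<^sub>0:
  "hilbert_module (unitalization C\<^sub>0) (C\<^sub>0 :: ('a::topological_space \<Rightarrow>\<^sub>C complex) set) (*) C\<^sub>0_inner"
proof
  show "cstar_subalgebra (unitalization (C\<^sub>0 :: ('a \<Rightarrow>\<^sub>C complex) set))"
    by (intro cstar_subalgebra_unitalization cstar_subalgebra_C\<^sub>0)
  show "\<exists>e\<in>unitalization (C\<^sub>0 :: ('a \<Rightarrow>\<^sub>C complex) set).
     (\<forall>a\<in>unitalization C\<^sub>0. e * a = a \<and> a * e = a) \<and> (\<forall>x\<in>C\<^sub>0. x * e = x)"
  proof (cases "unital (C\<^sub>0 :: ('a \<Rightarrow>\<^sub>C complex) set)")
    case True
    then show ?thesis unfolding unitalization_def unital_def by auto
  next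
    case False
    have "1 = (0 :: 'a \<Rightarrow>\<^sub>C complex) + 1 *\<^sub>C 1" by (simp add: scaleC_1)
    then have "1 \<in> unitalization (C\<^sub>0 :: ('a \<Rightarrow>\<^sub>C complex) set)"
      using False C\<^sub>0_zero unfolding unitalization_def by (simp only: if_False) blast
    then show ?thesis by (intro bexI[of _ 1]) auto
  qed
  fix x y z :: "'a \<Rightarrow>\<^sub>C complex" and a b :: "'a \<Rightarrow>\<^sub>C complex"
  show "0 \<in> (C\<^sub>0 :: ('a \<Rightarrow>\<^sub>C complex) set)" by (rule C\<^sub>0_zero)
  show "x + y \<in> C\<^sub>0" if "x \<in> C\<^sub>0" "y \<in> C\<^sub>0" using that by (rule C\<^sub>0_add)
  show "- x \<in> C\<^sub>0" if "x \<in> C\<^sub>0" using C\<^sub>0_scaleC[OF that, of "-1"] by (simp add: scaleC_minus_1)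
  show "x * a \<in> C\<^sub>0" if "x \<in> C\<^sub>0" using that by (rule C\<^sub>0_mult_right)
  show "(x + y) * a = x * a + y * a" by (rule distrib_right)
  show "x * (a + b) = x * a + x * b" by (rule distrib_left)
  show "x * a * b = x * (a * b)" by (rule mult.assoc)
  show "C\<^sub>0_inner x y \<in> unitalization C\<^sub>0" if "x \<in> C\<^sub>0" "y \<in> C\<^sub>0"
    using that subset_unitalization C\<^sub>0_mult_right C\<^sub>0_star unfolding C\<^sub>0_inner_def by blast
  show "C\<^sub>0_inner x (y + z) = C\<^sub>0_inner x y + C\<^sub>0_inner x z"
    by (simp add: C\<^sub>0_inner_def distrib_left)
  show "C\<^sub>0_inner x (y * a) = C\<^sub>0_inner x y * a" by (simp add: C\<^sub>0_inner_def mult.assoc)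
  show "C\<^sub>0_inner y x = star (C\<^sub>0_inner x y)" by (simp add: C\<^sub>0_inner_def star_mult star_star)
  show "C\<^sub>0_inner x x \<in> positive_elements (unitalization C\<^sub>0)" if "x \<in> C\<^sub>0"
    using that subset_unitalization unfolding C\<^sub>0_inner_def positive_elements_def by blast
  show "x = 0" if "C\<^sub>0_inner x x = 0"
    using that cstar_identity[of x] by (simp add: C\<^sub>0_inner_def)
  have nrm: "sqrt (norm (C\<^sub>0_inner f f)) = norm f" for f :: "'a \<Rightarrow>\<^sub>C complex"
    by (simp add: C\<^sub>0_inner_def cstar_identity)
  show "\<exists>x\<in>C\<^sub>0. (\<lambda>n. sqrt (norm (C\<^sub>0_inner (X n - x) (X n - x)))) \<longlonglongrightarrow> 0"
    if X: "\<And>n. X n \<in> C\<^sub>0" and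
      C: "\<And>e. e > 0 \<Longrightarrow> \<exists>M. \<forall>m\<ge>M. \<forall>n\<ge>M. sqrt (norm (C\<^sub>0_inner (X m - X n) (X m - X n))) < e"
    for X :: "nat \<Rightarrow> 'a \<Rightarrow>\<^sub>C complex"
  proof -
    have "Cauchy X" using C unfolding nrm Cauchy_def dist_norm by blast
    then obtain l where "l \<in> C\<^sub>0" "X \<longlonglongrightarrow> l"
      using X complete_C\<^sub>0 unfolding complete_def by blast
    then show ?thesis unfolding nrm using LIM_zero tendsto_norm_zero by blast
  qed
qed

end

theory Submission
  imports Defs
begin

text \<open>
  Multiplying the frame inequality by a function of \<open>C\<^sub>0\<close> that does not vanish at \<open>t\<close> shows that
  some frame element is nonzero at \<open>t\<close>, so the cozero sets of the frame elements cover the space;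
  each of them is \<open>\<sigma>\<close>-compact. Norm convergence of the frame series at a function that is nonzero on
  a compact set leaves only countably many frame elements that are not identically zero there.
  A dense \<open>\<sigma>\<close>-compact set therefore leaves only countably many nonzero frame elements,
  and the whole space is \<open>\<sigma>\<close>-compact.
\<close>

text \<open>Cauchy criterion with single terms: once a finite \<open>F\<close> controls all larger
  partial sums to within \<open>e / 2\<close> of \<open>s\<close>, adding one index \<open>i\<close>
  outside \<open>F\<close> changes the sum by exactly \<open>f i\<close>, so
  \<open>norm (f i) < e\<close>.\<close>

lemma has_sum_finite_norm_ge:
  fixes f :: "'i \<Rightarrow> 'b::real_normed_vector"
  assumes "(f has_sum s) I" and "e > 0"
  shows "finite {i \<in> I. e \<le> norm (f i)}"
proof -
  have "(sum f \<longlongrightarrow> s) (finite_subsets_at_top I)"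
    using assms(1) by (simp only: has_sum_def)
  moreover have "0 < e / 2" using assms(2) by (rule half_gt_zero)
  ultimately have "\<forall>\<^sub>F F in finite_subsets_at_top I. dist (sum f F) s < e / 2"
    by (rule tendstoD)
  then have "\<exists>F. finite F \<and> F \<subseteq> I \<and>
      (\<forall>G. finite G \<and> F \<subseteq> G \<and> G \<subseteq> I \<longrightarrow> dist (sum f G) s < e / 2)"
    by (simp only: eventually_finite_subsets_at_top)
  then obtain F where F: "finite F" "F \<subseteq> I"
    and close: "\<forall>G. finite G \<and> F \<subseteq> G \<and> G \<subseteq> I \<longrightarrow> dist (sum f G) s < e / 2"
    by (elim exE conjE)
  have "norm (f i) < e" if i: "i \<in> I" "i \<notin> F" for i
  proof -
    have "dist (sum f (insert i F)) s < e / 2" "dist (sum f F) s < e / 2"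
      using F i close[rule_format, of "insert i F"] close[rule_format, of F] by blast+
    then have "dist (sum f (insert i F)) (sum f F) < e" by (rule dist_triangle_half_l)
    then show ?thesis using F i by (simp add: dist_norm)
  qed
  then have "{i \<in> I. e \<le> norm (f i)} \<subseteq> F" by force
  then show ?thesis using F(1) by (rule finite_subset)
qed

text \<open>By the Archimedean property every nonzero term has norm at least 1/(n+1) for some n, and
  for each n only finitely many terms do.\<close>

lemma has_sum_countable_support:
  fixes f :: "'i \<Rightarrow> 'b::real_normed_vector"
  assumes "(f has_sum s) I"
  shows "countable {i \<in> I. f i \<noteq> 0}"
proof -
  have "{i \<in> I. f i \<noteq> 0} = (\<Union>n. {i \<in> I. inverse (real (Suc n)) \<le> norm (f i)})"
  proof (intro subset_antisym subsetI)
    fix i assume i: "i \<in> {i \<in> I. f i \<noteq> 0}"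
    then obtain n where "inverse (real (Suc n)) < norm (f i)"
      using reals_Archimedean[of "norm (f i)"] by auto
    with i show "i \<in> (\<Union>n. {i \<in> I. inverse (real (Suc n)) \<le> norm (f i)})"
      by (auto intro: less_imp_le)
  next
    fix i assume "i \<in> (\<Union>n. {i \<in> I. inverse (real (Suc n)) \<le> norm (f i)})"
    then obtain n where "i \<in> I" "inverse (real (Suc n)) \<le> norm (f i)" by blast
    moreover have "0 < inverse (real (Suc n))" by simp
    ultimately show "i \<in> {i \<in> I. f i \<noteq> 0}" by force
  qed
  moreover have "countable {i \<in> I. inverse (real (Suc n)) \<le> norm (f i)}" for n
    by (intro countable_finite has_sum_finite_norm_ge[OF assms]) simp
  ultimately show ?thesis by simp
qed

text \<open>Continuity of evaluation lets the norm-convergent frame series be summed pointwise at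
  \<open>t\<close>.\<close>

lemma bounded_linear_apply_bcontfun: "bounded_linear (\<lambda>f. apply_bcontfun f t)"
  by (rule bounded_linear_intro[where K = 1]) (simp_all add: norm_bounded)

lemma sigma_compact_UN:
  assumes "countable I" and "\<And>i. i \<in> I \<Longrightarrow> sigma_compact (S i)"
  shows "sigma_compact (\<Union>i\<in>I. S i)"
  using assms unfolding sigma_compact_def by (intro countable_union_of_UN)

lemma compact_imp_sigma_compact: "compact S \<Longrightarrow> sigma_compact S"
  unfolding sigma_compact_def by (rule countable_union_of_inc)

lemma sigma_compact_cozero_C\<^sub>0:
  fixes f :: "'a::topological_space \<Rightarrow>\<^sub>C complex"
  assumes "f \<in> C\<^sub>0"
  shows "sigma_compact {t. apply_bcontfun f t \<noteq> 0}"
proof -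
  have "compact {t. e \<le> cmod (apply_bcontfun f t)}" if e: "e > 0" for e
  proof -
    obtain C where C: "compact C" "\<And>t. t \<notin> C \<Longrightarrow> cmod (apply_bcontfun f t) < e"
      using assms e unfolding C\<^sub>0_def vanishes_at_infinity_def by blast
    \<comment> \<open>The superlevel set lies inside \<open>C\<close>, so being closed makes it
      compact.\<close>
    have "closed {t. e \<le> cmod (apply_bcontfun f t)}"
      by (intro closed_Collect_le continuous_intros continuous_on_apply_bcontfun)
    with C(1) have "compact (C \<inter> {t. e \<le> cmod (apply_bcontfun f t)})"
      by (rule compact_Int_closed)
    moreover have "C \<inter> {t. e \<le> cmod (apply_bcontfun f t)} = {t. e \<le> cmod (apply_bcontfun f t)}"
      using C(2) by force
    ultimately show ?thesis by simp
  qed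
  then have "sigma_compact (\<Union>n. {t. inverse (real (Suc n)) \<le> cmod (apply_bcontfun f t)})"
    by (intro sigma_compact_UN compact_imp_sigma_compact) auto
  moreover have "{t. apply_bcontfun f t \<noteq> 0}
      = (\<Union>n. {t. inverse (real (Suc n)) \<le> cmod (apply_bcontfun f t)})"
  proof (intro subset_antisym subsetI)
    fix t assume "t \<in> {t. apply_bcontfun f t \<noteq> 0}"
    then obtain n where "inverse (real (Suc n)) < cmod (apply_bcontfun f t)"
      using reals_Archimedean[of "cmod (apply_bcontfun f t)"] by auto
    then show "t \<in> (\<Union>n. {t. inverse (real (Suc n)) \<le> cmod (apply_bcontfun f t)})"
      by (auto intro: less_imp_le)
  next
    fix t assume "t \<in> (\<Union>n. {t. inverse (real (Suc n)) \<le> cmod (apply_bcontfun f t)})"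
    then obtain n where "inverse (real (Suc n)) \<le> cmod (apply_bcontfun f t)" by blast
    moreover have "0 < inverse (real (Suc n))" by simp
    ultimately show "t \<in> {t. apply_bcontfun f t \<noteq> 0}" by force
  qed
  ultimately show ?thesis by simp
qed

text \<open>Urysohn's lemma: a locally compact Hausdorff space is completely regular, so a
  continuous function can be 1 on \<open>S\<close> and 0 off an open neighbourhood \<open>U\<close>
  of \<open>S\<close> that lies in a compact set \<open>L\<close>.\<close>

lemma C\<^sub>0_nonzero_on_compact:
  fixes S :: "'a::t2_space set"
  assumes lc: "locally_compact_space (euclidean :: 'a topology)" and S: "compact S"
  obtains f where "f \<in> C\<^sub>0" "\<And>t. t \<in> S \<Longrightarrow> apply_bcontfun f t \<noteq> 0"
proof -
  have H: "Hausdorff_space (euclidean :: 'a topology)"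
    by (simp add: Hausdorff_space_def disjnt_def) (metis hausdorff)
  then obtain U L where U: "open U" "compact L" "S \<subseteq> U" "U \<subseteq> L"
    using lc S locally_compact_space_compact_closed_compact[OF disjI1[OF H]]
    by (metis compactin_euclidean_iff open_openin)
  have "completely_regular_space (euclidean :: 'a topology)"
    using lc H by (blast intro: locally_compact_regular_imp_completely_regular_space)
  then obtain g :: "'a \<Rightarrow> real" where g: "continuous_on UNIV g" "g ` S \<subseteq> {1}" "g ` (- U) \<subseteq> {0}"
  proof (rule Urysohn_completely_regular_compact_closed_alt[where a = 0 and b = 1])
    show "compactin euclidean S" "closedin euclidean (- U)" "disjnt S (- U)"
      using S U(1,3) by (auto simp: disjnt_def)
  qed (auto intro: that)
  have "continuous_on UNIV (\<lambda>t. complex_of_real (g t))"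
    using g(1) by (intro continuous_intros)
  \<comment> \<open>\<open>L\<close> serves every bound at once, since \<open>g\<close> is 0 outside
    \<open>U\<close>, hence outside \<open>L\<close>.\<close>
  moreover have "vanishes_at_infinity (\<lambda>t. complex_of_real (g t))"
    unfolding vanishes_at_infinity_def using U g(3) by (intro allI impI exI[of _ L]) force
  ultimately have "(\<lambda>t. complex_of_real (g t)) \<in> apply_bcontfun ` C\<^sub>0"
    unfolding apply_bcontfun_image_C\<^sub>0 by simp
  then obtain f where "f \<in> C\<^sub>0" "apply_bcontfun f = (\<lambda>t. complex_of_real (g t))"
    by (metis imageE)
  moreover have "complex_of_real (g t) \<noteq> 0" if "t \<in> S" for t
    using g(2) that by force
  ultimately show thesis using that by simp
qed

lemma standard_frame_C\<^sub>0_member: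
  "standard_frame A C\<^sub>0 ip J x \<Longrightarrow> j \<in> J \<Longrightarrow> x j \<in> C\<^sub>0"
  by (simp add: standard_frame_def)

text \<open>If all frame elements vanished at \<open>t\<close>, so would the sum of the frame series
  for any \<open>y\<close>; the lower frame bound for a \<open>y\<close> with \<open>y(t)\<close>
  nonzero rules this out.\<close>

lemma standard_frame_C\<^sub>0_nonvanishing:
  fixes x :: "'j \<Rightarrow> 'a::t2_space \<Rightarrow>\<^sub>C complex"
  assumes lc: "locally_compact_space (euclidean :: 'a topology)"
    and frame: "standard_frame A C\<^sub>0 C\<^sub>0_inner J x"
  shows "\<exists>j\<in>J. apply_bcontfun (x j) t \<noteq> 0"
proof (rule ccontr)
  assume "\<not> ?thesis"
  then have x0: "apply_bcontfun (x j) t = 0" if "j \<in> J" for j using that by blast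
  obtain y where y: "y \<in> C\<^sub>0" "apply_bcontfun y t \<noteq> 0"
    using C\<^sub>0_nonzero_on_compact[OF lc, of "{t}"] by auto
  obtain c s where c: "c > 0"
    and s: "((\<lambda>j. C\<^sub>0_inner y (x j) * C\<^sub>0_inner (x j) y) has_sum s) J"
    and lower: "cstar_le A (c *\<^sub>R C\<^sub>0_inner y y) s"
    using frame y(1) unfolding standard_frame_def by blast
  have "((\<lambda>j. apply_bcontfun (C\<^sub>0_inner y (x j) * C\<^sub>0_inner (x j) y) t) has_sum
      apply_bcontfun s t) J"
    using has_sum_bounded_linear[OF bounded_linear_apply_bcontfun s] .
  moreover have "((\<lambda>j. apply_bcontfun (C\<^sub>0_inner y (x j) * C\<^sub>0_inner (x j) y) t) has_sum 0) J"
    by (rule has_sum_0) (simp add: C\<^sub>0_inner_def x0)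
  ultimately have s0: "apply_bcontfun s t = 0" by (rule has_sum_unique)
  obtain b where "s - c *\<^sub>R C\<^sub>0_inner y y = star b * b"
    using lower unfolding cstar_le_def positive_elements_def by blast
  then have "apply_bcontfun (s - c *\<^sub>R C\<^sub>0_inner y y) t = apply_bcontfun (star b * b) t" by simp
  \<comment> \<open>Real parts turn the algebraic order into a real identity: a strictly negative
    number on the left, a square on the right.\<close>
  then have "Re (apply_bcontfun (s - c *\<^sub>R C\<^sub>0_inner y y) t) = Re (apply_bcontfun (star b * b) t)"
    by (rule arg_cong)
  then have "- (c * (cmod (apply_bcontfun y t))\<^sup>2) = (cmod (apply_bcontfun b t))\<^sup>2"
    by (simp add: C\<^sub>0_inner_def s0 star_complex_def cmod_power2 flip: power2_eq_square)
  moreover have "c * (cmod (apply_bcontfun y t))\<^sup>2 > 0" using c y(2) by simp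
  ultimately show False using zero_le_power2[of "cmod (apply_bcontfun b t)"] by linarith
qed

text \<open>For \<open>y\<close> without zeros on \<open>S\<close>, the j-th frame term has value
  \<bar>y(t)\<bar>^2 \<bar>x_j(t)\<bar>^2 at \<open>t\<close>, so each \<open>x j\<close> that is
  nonzero somewhere on \<open>S\<close> gives a nonzero term of a convergent series.\<close>

lemma standard_frame_C\<^sub>0_countable_on_compact:
  fixes x :: "'j \<Rightarrow> 'a::t2_space \<Rightarrow>\<^sub>C complex"
  assumes lc: "locally_compact_space (euclidean :: 'a topology)"
    and frame: "standard_frame A C\<^sub>0 C\<^sub>0_inner J x"
    and S: "compact S"
  shows "countable {j \<in> J. \<exists>t\<in>S. apply_bcontfun (x j) t \<noteq> 0}"
proof -
  obtain y where y: "y \<in> C\<^sub>0" "\<And>t. t \<in> S \<Longrightarrow> apply_bcontfun y t \<noteq> 0"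
    using C\<^sub>0_nonzero_on_compact[OF lc S] by blast
  let ?f = "\<lambda>j. C\<^sub>0_inner y (x j) * C\<^sub>0_inner (x j) y"
  obtain s where "(?f has_sum s) J"
    using frame y(1) unfolding standard_frame_def by blast
  then have "countable {j \<in> J. ?f j \<noteq> 0}" by (rule has_sum_countable_support)
  moreover have "?f j \<noteq> 0" if "t \<in> S" "apply_bcontfun (x j) t \<noteq> 0" for j t
  proof -
    have "apply_bcontfun (?f j) t \<noteq> 0"
      using y(2)[OF that(1)] that(2) by (simp add: C\<^sub>0_inner_def star_complex_def)
    then show ?thesis by force
  qed
  then have "{j \<in> J. \<exists>t\<in>S. apply_bcontfun (x j) t \<noteq> 0} \<subseteq> {j \<in> J. ?f j \<noteq> 0}" by blast
  ultimately show ?thesis using countable_subset by blast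
qed

text \<open>The zero set of a continuous function is closed, so if it contained \<open>D\<close> it
  would be the whole space.\<close>

lemma bcontfun_nonzero_on_dense:
  fixes f :: "'a::topological_space \<Rightarrow>\<^sub>C 'b::real_normed_vector"
  assumes "closure D = UNIV" and "apply_bcontfun f t \<noteq> 0"
  shows "\<exists>d\<in>D. apply_bcontfun f d \<noteq> 0"
proof (rule ccontr)
  assume "\<not> ?thesis"
  then have "D \<subseteq> {d. apply_bcontfun f d = 0}" by blast
  moreover have "closed {d. apply_bcontfun f d = 0}"
    by (intro closed_Collect_eq continuous_on_apply_bcontfun continuous_on_const)
  ultimately have "closure D \<subseteq> {d. apply_bcontfun f d = 0}" by (rule closure_minimal)
  with assms show False by blast
qed

theorem theorem2p4:
  assumes "locally_compact_space (euclidean :: 'a::t2_space topology)"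
    and "\<not> sigma_compact (UNIV :: 'a set)"
    and "\<exists>D :: 'a set. sigma_compact D \<and> closure D = UNIV"
  shows "\<not> (\<exists>(J :: 'j set) (x :: 'j \<Rightarrow> 'a \<Rightarrow>\<^sub>C complex).
              standard_frame (unitalization C\<^sub>0) C\<^sub>0 C\<^sub>0_inner J x)"
proof
  assume "\<exists>(J :: 'j set) (x :: 'j \<Rightarrow> 'a \<Rightarrow>\<^sub>C complex).
              standard_frame (unitalization C\<^sub>0) C\<^sub>0 C\<^sub>0_inner J x"
  then obtain J :: "'j set" and x :: "'j \<Rightarrow> 'a \<Rightarrow>\<^sub>C complex" where
    frame: "standard_frame (unitalization C\<^sub>0) C\<^sub>0 C\<^sub>0_inner J x"
    by blast
  obtain D :: "'a set" where "sigma_compact D" and dense: "closure D = UNIV"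
    using assms(3) by blast
  then obtain \<S> where \<S>: "countable \<S>" "\<And>S. S \<in> \<S> \<Longrightarrow> compact S" "\<Union>\<S> = D"
    unfolding sigma_compact_def union_of_def by blast
  \<comment> \<open>Indices of the frame elements that are nonzero somewhere on \<open>D\<close>,
    grouped by compact piece so that each group is countable.\<close>
  define I where "I = (\<Union>S\<in>\<S>. {j \<in> J. \<exists>t\<in>S. apply_bcontfun (x j) t \<noteq> 0})"
  have "countable I"
    unfolding I_def using \<S>
    by (intro countable_UN standard_frame_C\<^sub>0_countable_on_compact[OF assms(1) frame])
  moreover have "I \<subseteq> J" unfolding I_def by blast
  ultimately have "sigma_compact (\<Union>j\<in>I. {t. apply_bcontfun (x j) t \<noteq> 0})"
    using standard_frame_C\<^sub>0_member[OF frame]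
    by (intro sigma_compact_UN sigma_compact_cozero_C\<^sub>0) auto
  moreover have "(\<Union>j\<in>I. {t. apply_bcontfun (x j) t \<noteq> 0}) = UNIV"
  proof -
    have "\<exists>j\<in>I. apply_bcontfun (x j) t \<noteq> 0" for t
    proof -
      obtain j where j: "j \<in> J" "apply_bcontfun (x j) t \<noteq> 0"
        using standard_frame_C\<^sub>0_nonvanishing[OF assms(1) frame] by blast
      \<comment> \<open>Density moves the nonzero value from \<open>t\<close> to a point of
        \<open>D\<close>, hence to one of the compact pieces.\<close>
      then have "j \<in> I"
        using bcontfun_nonzero_on_dense[OF dense j(2)] \<S>(3) unfolding I_def by blast
      with j show ?thesis by blast
    qed
    then show ?thesis by blast
  qed
  ultimately show False using assms(2) by simp
qed

end
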